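(* Given any $f_1\in D_{12}$ and $f_2\in D_{21}$, there exist multipliers $\lambda^{12}=(\lambda_0^{12},\lambda_1^{12},\lambda_2^{12})$ and $\lambda^{21}=(\lambda_0^{21},\lambda_1^{21},\lambda_2^{21})$ in $\mathbb{R}\times\mathbb{R}^3\times\mathbb{R}$ such that $\lambda_1^{21}=\lambda_1^{12}$, $\lambda_2^{21}=\lambda_2^{12}$, and the corresponding functions $$M_{12}(v)=\exp\left(m_1\lambda^{12}_0+m_1\lambda^{12}_1\cdot v+m_1\lambda^{12}_2|v|^2\right),\qquad M_{21}(v)=\exp\left(m_2\lambda^{21}_0+m_2\lambda^{21}_1\cdot v+m_2\lambda^{21}_2|v|^2\right)$$ satisfy $$\int m_1\nu_{12}(M_{12}-f_1)\,dv=0,\qquad \int m_2\nu_{21}(M_{21}-f_2)\,dv=0,$$ $$\int m_1\nu_{12}\begin{pmatrix}v\\|v|^2\end{pmatrix}(M_{12}-f_1)\,dv+\int m_2\nu_{21}\begin{pmatrix}v\\|v|^2\end{pmatrix}(M_{21}-f_2)\,dv=0 .$$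
   Context: Here $m_1,m_2>0$ are particle masses and integrals are over $v\in\mathbb{R}^3$. For $\lambda=(\lambda_0,\lambda_1,\lambda_2)\in\mathbb{R}\times\mathbb{R}^3\times\mathbb{R}=\mathbb{R}^5$ let $\exp^k_\lambda(v)=\exp(\lambda\cdot a^k(v))$ with $a^k(v)=(m_k,\,m_kv,\,m_k|v|^2)^T\in\mathbb{R}^5$. Let $\nu_{12},\nu_{21}$ be measurable functions of $v\in\mathbb{R}^3$ (the collision frequencies) and, for $(k,j)\in\{(1,2),(2,1)\}$, $$D_{kj}=\{g\ge 0\mid \nu_{kj}(1+|v|^2)g\in L^1(\mathbb{R}^3),\ g\not\equiv 0\}$$ (with $g\not\equiv0$ understood up to null sets). Standing assumption on the collision frequencies: for $(k,j)\in\{(1,2),(2,1)\}$, $\nu_{kj}$ is strictly positive and $$\{\lambda\in\mathbb{R}^5\mid \exp^k_\lambda\in D_{kj}\}=\{\lambda\in\mathbb{R}^5\mid\exp^k_\lambda\in L^1(\mathbb{R}^3)\}=\{\lambda\in\mathbb{R}^5\mid\lambda_2<0\}.$$ *)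

theory Defs
  imports "HOL-Analysis.Analysis"
begin

text \<open>
  The space \<open>\<real>\<^sup>5\<close> of multipliers is represented as \<open>\<real> \<times> \<real>\<^sup>3 \<times> \<real>\<close>; the inner product of the
  product type is the Euclidean one.
\<close>

type_synonym vel = "real ^ 3"
type_synonym multiplier = "real \<times> vel \<times> real"

definition moment_vec :: "real \<Rightarrow> vel \<Rightarrow> multiplier" where
  "moment_vec m v = (m, m *\<^sub>R v, m * (norm v)\<^sup>2)"

definition exp_mult :: "real \<Rightarrow> multiplier \<Rightarrow> vel \<Rightarrow> real" where
  "exp_mult m l v = exp (l \<bullet> moment_vec m v)"

text \<open>
  Measurability of \<open>g\<close> is not listed separately: for measurable, strictly positive \<open>\<nu>\<close> it follows
  from integrability of the product.
\<close>

definition coll_dom :: "(vel \<Rightarrow> real) \<Rightarrow> (vel \<Rightarrow> real) set" where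
  "coll_dom \<nu> = {g. (\<forall>v. g v \<ge> 0)
     \<and> integrable lebesgue (\<lambda>v. \<nu> v * (1 + (norm v)\<^sup>2) * g v)
     \<and> \<not> (AE v in lebesgue. g v = 0)}"

end

theory Submission
  imports Defs
begin

text \<open>
  Write \<open>\<theta> = (\<lambda>\<^sub>1, \<lambda>\<^sub>2)\<close> for the common multipliers, \<open>w(v) = (v, \<bar>v\<bar>\<^sup>2)\<close>,
  \<open>Z\<^sub>k(\<theta>) = \<integral> \<nu>\<^sub>k exp(\<theta> \<bullet> w)\<close>, \<open>\<rho>\<^sub>k = \<integral> \<nu>\<^sub>k f\<^sub>k\<close> and \<open>U\<^sub>k = \<integral> \<nu>\<^sub>k f\<^sub>k w\<close>. The two mass
  constraints determine the \<open>\<lambda>\<^sub>0\<close> components, and the remaining constraint says that \<open>\<theta>\<close> is a critical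
  point of the dual functional
  \<open>F(\<theta>) = \<Sum>\<^sub>k (\<rho>\<^sub>k ln Z\<^sub>k(m\<^sub>k\<theta>) - m\<^sub>k\<theta> \<bullet> U\<^sub>k)\<close> on the half space \<open>\<lambda>\<^sub>2 < 0\<close>.
  Since \<open>U\<^sub>k/\<rho>\<^sub>k\<close> lies strictly above the paraboloid \<open>w(\<real>\<^sup>n)\<close>, \<open>F\<close> is coercive. A minimiser over
  \<open>\<lambda>\<^sub>2 \<le> -1/n\<close> that is not critical lies on the bounding hyperplane and has \<open>\<partial>F/\<partial>\<lambda>\<^sub>2 \<le> 0\<close>. If
  this happened for all \<open>n\<close>, the minimisers would accumulate at some \<open>(b, 0)\<close>, and Fatou's lemma would
  make \<open>\<nu>\<^sub>1 (1 + \<bar>v\<bar>\<^sup>2) exp(m\<^sub>1 b \<bullet> v)\<close> integrable, which the assumption on \<open>\<nu>\<^sub>1\<close> excludes. (The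
  value \<open>Z\<^sub>1(m\<^sub>1 b, 0)\<close> itself may be finite, so \<open>F\<close> need not blow up at the boundary.)
\<close>

section \<open>Critical points on a half space\<close>

text \<open>Minimisation over compact truncations of the open half space needs no boundary values of
  \<open>F\<close>. A truncated minimiser that is not critical has
  \<open>snd (grad \<theta>) \<le> 0\<close>, which \<open>boundary\<close> forbids along a whole
  sequence tending to the hyperplane.\<close>

lemma halfspace_critical_point:
  fixes F :: "'a::euclidean_space \<times> real \<Rightarrow> real" and grad :: "'a \<times> real \<Rightarrow> 'a \<times> real"
  assumes der: "\<And>\<theta>. snd \<theta> < 0 \<Longrightarrow> (F has_derivative (\<lambda>h. h \<bullet> grad \<theta>)) (at \<theta>)"
    and coercive: "\<And>K. \<exists>R. \<forall>\<theta>. snd \<theta> < 0 \<longrightarrow> F \<theta> \<le> K \<longrightarrow> norm \<theta> \<le> R"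
    and boundary: "\<And>X L. \<lbrakk>X \<longlonglongrightarrow> L; \<And>n. snd (X n) < 0; snd L = 0\<rbrakk>
      \<Longrightarrow> \<exists>n. snd (grad (X n)) > 0"
  shows "\<exists>\<theta>. snd \<theta> < 0 \<and> grad \<theta> = 0"
proof (rule ccontr)
  assume nocrit: "\<not> ?thesis"
  define p where "p = (0::'a, -1::real)"
  obtain R where R: "\<And>\<theta>. snd \<theta> < 0 \<Longrightarrow> F \<theta> \<le> F p \<Longrightarrow> norm \<theta> \<le> R"
    using coercive[of "F p"] by blast
  have p: "snd p < 0" "norm p = 1" by (auto simp: p_def norm_Pair)
  have R1: "1 \<le> R" using R[of p] p by simp
  \<comment> \<open>The radius exceeds \<open>R\<close> by 1, so a minimiser, of norm at most
    \<open>R\<close>, is never on the sphere and may still be moved by a vector of length 1. Since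
    \<open>1/(n+1) \<le> 1\<close>, every \<open>S n\<close> contains \<open>p\<close>.\<close>
  define S where "S = (\<lambda>n::nat. cball (0::'a \<times> real) (R + 1) \<inter> {\<theta>. snd \<theta> \<le> - inverse (real (Suc n))})"
  have inv1: "inverse (real (Suc n)) \<le> 1" for n by (simp add: field_simps)
  have inv0: "inverse (real (Suc n)) > 0" for n by simp
  have S_neg: "\<theta> \<in> S n \<Longrightarrow> snd \<theta> < 0" for \<theta> n
    unfolding S_def using inv0[of n] by (auto simp del: of_nat_Suc inverse_positive_iff_positive)
  have pS: "p \<in> S n" for n using R1 p inv1[of n] unfolding S_def by (auto simp: p_def)
  have "\<exists>x\<in>S n. \<forall>y\<in>S n. F x \<le> F y" for n
  proof (rule continuous_attains_inf)
    show "compact (S n)" unfolding S_def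
      by (intro compact_Int_closed compact_cball closed_Collect_le continuous_intros)
    show "S n \<noteq> {}" using pS by blast
    show "continuous_on (S n) F"
      using der S_neg by (meson continuous_at_imp_continuous_on has_derivative_continuous)
  qed
  then obtain X where X: "\<And>n. X n \<in> S n" "\<And>n y. y \<in> S n \<Longrightarrow> F (X n) \<le> F y" by metis
  have Xneg: "snd (X n) < 0" for n using X(1) S_neg by blast
  have XR: "norm (X n) \<le> R" for n using R[OF Xneg] X(2) pS by blast
  have Xgrad: "snd (X n) = - inverse (real (Suc n)) \<and> snd (grad (X n)) \<le> 0" for n
  proof
    \<comment> \<open>Off the hyperplane \<open>X n\<close> would be interior to \<open>S n\<close>,
      hence a critical point.\<close>
    show eq: "snd (X n) = - inverse (real (Suc n))"
    proof (rule ccontr)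
      assume ne: "snd (X n) \<noteq> - inverse (real (Suc n))"
      define U where "U = ball (0::'a \<times> real) (R + 1) \<inter> {\<theta>. snd \<theta> < - inverse (real (Suc n))}"
      have "open U" unfolding U_def
        by (intro open_Int open_ball open_Collect_less continuous_intros)
      moreover have "X n \<in> U" using ne X(1)[of n] XR[of n] by (auto simp: U_def S_def)
      moreover have "U \<subseteq> S n" by (auto simp: U_def S_def)
      ultimately have "(\<lambda>h. h \<bullet> grad (X n)) = (\<lambda>v. 0)"
        using differential_zero_maxmin[of "X n" U F] der[OF Xneg] X(2) by blast
      then have "grad (X n) \<bullet> grad (X n) = 0" by metis
      then show False using nocrit Xneg by (metis inner_eq_zero_iff)
    qed
    show "snd (grad (X n)) \<le> 0"
    proof (rule ccontr)
      assume pos: "\<not> snd (grad (X n)) \<le> 0"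
      \<comment> \<open>Direction away from the boundary: a positive last gradient component would
        make \<open>F\<close> decrease along \<open>d\<close>, without leaving
        \<open>S n\<close>.\<close>
      define d where "d = (0::'a, -1::real)"
      have "((\<lambda>t. F (X n + t *\<^sub>R d)) has_derivative (\<lambda>t. (t *\<^sub>R d) \<bullet> grad (X n))) (at (0::real))"
        using der[OF Xneg[of n]]
        by (intro has_derivative_compose[of "\<lambda>t. X n + t *\<^sub>R d" "\<lambda>t. t *\<^sub>R d" 0 UNIV F])
           (auto intro!: derivative_eq_intros)
      then have "((\<lambda>t. F (X n + t *\<^sub>R d)) has_field_derivative (- snd (grad (X n)))) (at 0)"
        by (rule has_derivative_imp_has_field_derivative) (auto simp: d_def inner_prod_def)
      from DERIV_neg_dec_right[OF this] pos obtain e where e: "e > 0"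
        "\<And>h. 0 < h \<Longrightarrow> h < e \<Longrightarrow> F (X n + h *\<^sub>R d) < F (X n)" by auto
      define h where "h = min (e/2) 1"
      have h: "0 < h" "h < e" "h \<le> 1" using e(1) by (auto simp: h_def)
      have "norm (X n + h *\<^sub>R d) \<le> norm (X n) + norm (h *\<^sub>R d)" by (rule norm_triangle_ineq)
      also have "\<dots> \<le> R + 1" using XR[of n] h by (simp add: d_def norm_Pair)
      finally have "X n + h *\<^sub>R d \<in> S n" using eq h by (auto simp: S_def d_def)
      then show False using X(2) e(2)[OF h(1,2)] by fastforce
    qed
  qed
  \<comment> \<open>A convergent subsequence of the minimisers has its limit on the hyperplane,
    because their last coordinates are \<open>- 1/(n+1)\<close>.\<close>
  have "bounded (range X)" using XR by (auto simp: bounded_iff)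
  then obtain L r where r: "strict_mono r" "(X \<circ> r) \<longlonglongrightarrow> L"
    using bounded_imp_convergent_subsequence by blast
  have "(\<lambda>n. snd ((X \<circ> r) n)) \<longlonglongrightarrow> snd L" using r(2) by (rule tendsto_snd)
  moreover have "(\<lambda>n. snd ((X \<circ> r) n)) \<longlonglongrightarrow> - 0"
    using LIMSEQ_subseq_LIMSEQ[OF tendsto_minus[OF LIMSEQ_inverse_real_of_nat] r(1)] Xgrad
    by (simp add: o_def)
  ultimately have "snd L = 0" using LIMSEQ_unique by fastforce
  then show False using boundary[OF r(2)] Xneg Xgrad by (metis comp_apply not_less)
qed

section \<open>Exponential integrals over the moments \<open>(v, \<bar>v\<bar>\<^sup>2)\<close>\<close>

definition vsq :: "'a::euclidean_space \<Rightarrow> 'a \<times> real" where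
  "vsq v = (v, (norm v)\<^sup>2)"

lemma fst_vsq [simp]: "fst (vsq v) = v" and snd_vsq [simp]: "snd (vsq v) = (norm v)\<^sup>2"
  by (simp_all add: vsq_def)

lemma inner_vsq: "\<theta> \<bullet> vsq v = fst \<theta> \<bullet> v + snd \<theta> * (norm v)\<^sup>2"
  by (simp add: inner_prod_def)

lemma norm_vsq_le: "norm (vsq v) \<le> 1 + (norm v)\<^sup>2"
  unfolding norm_prod_def
  by (rule real_le_lsqrt) (auto simp: power2_eq_square algebra_simps)

lemma abs_inner_vsq_le: "\<bar>h \<bullet> vsq v\<bar> \<le> norm h * (1 + (norm v)\<^sup>2)"
  using Cauchy_Schwarz_ineq2[of h "vsq v"] norm_vsq_le[of v]
  by (meson mult_left_mono norm_ge_zero order_trans)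

lemma continuous_on_vsq [continuous_intros]: "continuous_on A vsq"
  unfolding vsq_def by (intro continuous_intros)

section \<open>Measurability, positivity of integrals and a Taylor bound\<close>

lemma borel_measurable_lebesgue_continuous:
  fixes g :: "'a::euclidean_space \<Rightarrow> 'b::euclidean_space"
  assumes "continuous_on UNIV g"
  shows "g \<in> borel_measurable lebesgue"
  using assms by (intro measurable_completion) (simp add: borel_measurable_continuous_onI)

lemma integral_pos:
  fixes g :: "'a \<Rightarrow> real"
  assumes "integrable M g" "\<And>x. g x \<ge> 0" "\<not> (AE x in M. g x = 0)"
  shows "integral\<^sup>L M g > 0"
  using integral_nonneg_eq_0_iff_AE[OF assms(1)] assms(2,3)
  by (smt (verit) AE_I2 integral_nonneg_AE)

lemma not_AE_lebesgue_open:
  fixes U :: "'a::euclidean_space set"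
  assumes "open U" "u \<in> U" "\<And>x. x \<in> U \<Longrightarrow> \<not> P x"
  shows "\<not> (AE x in lebesgue. P x)"
proof
  assume "AE x in lebesgue. P x"
  then have "AE x in lebesgue. x \<notin> U" by eventually_elim (use assms(3) in blast)
  then have "negligible U"
    using assms(1) by (simp add: AE_iff_null_sets negligible_iff_null_sets)
  then show False using open_not_negligible assms(1,2) by blast
qed

text \<open>Second-order Lagrange remainder; the bound is even in \<open>x\<close>, so it can be
  dominated knowing only the size of \<open>x\<close>.\<close>

lemma abs_exp_minus_linear_le:
  fixes x :: real
  shows "\<bar>exp x - 1 - x\<bar> \<le> x\<^sup>2 * exp \<bar>x\<bar>"
proof -
  obtain t where t: "\<bar>t\<bar> \<le> \<bar>x\<bar>" "exp x = (\<Sum>k<2. x ^ k / fact k) + exp t / fact 2 * x ^ 2"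
    using Maclaurin_exp_le[of x 2] by blast
  then have "\<bar>exp x - 1 - x\<bar> = exp t / 2 * x\<^sup>2"
    by (simp add: numeral_2_eq_2)
  also have "\<dots> \<le> exp \<bar>x\<bar> * x\<^sup>2"
  proof (rule mult_right_mono)
    have "exp t \<le> exp \<bar>x\<bar>" using t(1) by simp
    then show "exp t / 2 \<le> exp \<bar>x\<bar>" using exp_ge_zero[of t] by linarith
  qed simp
  finally show ?thesis by (simp add: mult.commute)
qed

section \<open>Partition function of one species\<close>

text \<open>One species with its mass absorbed: \<theta> stands for
  \<open>m *\<^sub>R (\<lambda>\<^sub>1, \<lambda>\<^sub>2)\<close>, and the factor from
  \<open>\<lambda>\<^sub>0\<close> does not affect integrability.\<close>

locale collision_frequency =
  fixes \<nu> :: "'a::euclidean_space \<Rightarrow> real"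
  assumes meas [measurable]: "\<nu> \<in> borel_measurable lebesgue"
    and pos: "\<And>v. \<nu> v > 0"
    and integrable_iff:
      "\<And>\<theta>. integrable lebesgue (\<lambda>v. \<nu> v * (1 + (norm v)\<^sup>2) * exp (\<theta> \<bullet> vsq v)) \<longleftrightarrow> snd \<theta> < 0"
begin

definition Z :: "'a \<times> real \<Rightarrow> real" where
  "Z \<theta> = (LINT v|lebesgue. \<nu> v * exp (\<theta> \<bullet> vsq v))"

text \<open>Formal gradient of \<open>Z\<close>, obtained by differentiating under the integral
  sign.\<close>

definition D :: "'a \<times> real \<Rightarrow> 'a \<times> real" where
  "D \<theta> = (LINT v|lebesgue. (\<nu> v * exp (\<theta> \<bullet> vsq v)) *\<^sub>R vsq v)"

lemma measurable_exp_vsq [measurable]: "(\<lambda>v. exp (\<theta> \<bullet> vsq v)) \<in> borel_measurable lebesgue"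
  and measurable_inner_vsq [measurable]: "(\<lambda>v. \<theta> \<bullet> vsq v) \<in> borel_measurable lebesgue"
  and measurable_norm_lebesgue [measurable]: "norm \<in> borel_measurable lebesgue"
  and measurable_vsq [measurable]: "vsq \<in> borel_measurable lebesgue"
  by (auto intro!: borel_measurable_lebesgue_continuous continuous_intros)

lemma integrable_dominated:
  fixes g :: "'a \<Rightarrow> 'b::euclidean_space"
  assumes "snd \<theta> < 0" "g \<in> borel_measurable lebesgue"
    and "\<And>v. norm (g v) \<le> C * (\<nu> v * (1 + (norm v)\<^sup>2) * exp (\<theta> \<bullet> vsq v))"
  shows "integrable lebesgue g"
proof (rule Bochner_Integration.integrable_bound)
  show "integrable lebesgue (\<lambda>v. C * (\<nu> v * (1 + (norm v)\<^sup>2) * exp (\<theta> \<bullet> vsq v)))"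
    using assms(1) integrable_iff by auto
  show "AE x in lebesgue. norm (g x) \<le> norm (C * (\<nu> x * (1 + (norm x)\<^sup>2) * exp (\<theta> \<bullet> vsq x)))"
    using assms(3) by (intro AE_I2) (metis abs_ge_self order_trans real_norm_def)
qed (rule assms(2))

lemma integrable_Z: "snd \<theta> < 0 \<Longrightarrow> integrable lebesgue (\<lambda>v. \<nu> v * exp (\<theta> \<bullet> vsq v))"
  using pos by (intro integrable_dominated[where C=1]) (auto simp: abs_mult less_imp_le)

lemma integrable_D: "snd \<theta> < 0 \<Longrightarrow> integrable lebesgue (\<lambda>v. (\<nu> v * exp (\<theta> \<bullet> vsq v)) *\<^sub>R vsq v)"
  using pos norm_vsq_le by (intro integrable_dominated[where C=1])
    (auto simp: abs_mult less_imp_le mult_ac intro!: mult_left_mono)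

lemma snd_D: "snd \<theta> < 0 \<Longrightarrow> snd (D \<theta>) = (LINT v|lebesgue. \<nu> v * exp (\<theta> \<bullet> vsq v) * (norm v)\<^sup>2)"
  unfolding D_def
  using integral_bounded_linear[OF bounded_linear_snd integrable_D] by simp

lemma integrable_snd_D:
  "snd \<theta> < 0 \<Longrightarrow> integrable lebesgue (\<lambda>v. \<nu> v * exp (\<theta> \<bullet> vsq v) * (norm v)\<^sup>2)"
  using integrable_bounded_linear[OF bounded_linear_snd integrable_D] by simp

lemma inner_D: "snd \<theta> < 0 \<Longrightarrow> h \<bullet> D \<theta> = (LINT v|lebesgue. \<nu> v * exp (\<theta> \<bullet> vsq v) * (h \<bullet> vsq v))"
  unfolding D_def
  using integral_bounded_linear[OF bounded_linear_inner_right integrable_D, of \<theta> h] by simp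

lemma integrable_inner_D:
  "snd \<theta> < 0 \<Longrightarrow> integrable lebesgue (\<lambda>v. \<nu> v * exp (\<theta> \<bullet> vsq v) * (h \<bullet> vsq v))"
  using integrable_bounded_linear[OF bounded_linear_inner_right integrable_D, of \<theta> h] by simp

lemma Z_pos: "snd \<theta> < 0 \<Longrightarrow> Z \<theta> > 0"
  unfolding Z_def using pos
  by (intro integral_pos integrable_Z not_AE_lebesgue_open[of UNIV])
     (auto simp: less_imp_le less_imp_neq[symmetric] intro!: mult_nonneg_nonneg)

text \<open>The half space is open, so for small \<open>h\<close> the second-order remainder is at
  most \<open>(norm h)\<^sup>2\<close> times a fixed integrable function.\<close>

lemma has_derivative_Z:
  assumes \<theta>: "snd \<theta> < 0"
  shows "(Z has_derivative (\<lambda>h. h \<bullet> D \<theta>)) (at \<theta>)"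
proof -
  \<comment> \<open>Raising the last coordinate by \<open>2 * \<delta>\<close> gives
    \<open>snd \<theta> / 2\<close>, still negative. One \<delta> pays for the perturbation
    \<open>h\<close>, the other for a surplus polynomial weight.\<close>
  define \<delta> where "\<delta> = - snd \<theta> / 4"
  have \<delta>: "\<delta> > 0" using \<theta> by (simp add: \<delta>_def)
  \<comment> \<open>The squared weight comes from \<open>(h \<bullet> vsq v)\<^sup>2\<close>, the
    last exponential from \<open>exp \<bar>h \<bullet> vsq v\<bar>\<close> with
    \<open>norm h \<le> \<delta>\<close>.\<close>
  define B where "B = (\<lambda>v. \<nu> v * (1 + (norm v)\<^sup>2)\<^sup>2 * exp (\<theta> \<bullet> vsq v) * exp (\<delta> * (1 + (norm v)\<^sup>2)))"
  have B: "integrable lebesgue B"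
  proof (rule integrable_dominated[where \<theta> = "\<theta> + (0, 2 * \<delta>)" and C = "exp (2 * \<delta>) / \<delta>"])
    show "snd (\<theta> + (0, 2 * \<delta>)) < 0" using \<theta> by (simp add: \<delta>_def)
    show "B \<in> borel_measurable lebesgue" unfolding B_def by measurable
    fix v :: 'a
    define y where "y = 1 + (norm v)\<^sup>2"
    have y: "y > 0" by (simp add: y_def add_pos_nonneg)
    have "\<delta> * y \<le> exp (\<delta> * y)" using exp_ge_add_one_self[of "\<delta> * y"] by linarith
    then have 1: "y \<le> exp (\<delta> * y) / \<delta>" using \<delta> by (simp add: field_simps)
    have "norm (B v) = (\<nu> v * y * exp (\<theta> \<bullet> vsq v) * exp (\<delta> * y)) * y"
      unfolding B_def y_def[symmetric] using pos[of v] y by (simp add: abs_mult power2_eq_square)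
    also have "\<dots> \<le> (\<nu> v * y * exp (\<theta> \<bullet> vsq v) * exp (\<delta> * y)) * (exp (\<delta> * y) / \<delta>)"
      using pos[of v] y by (intro mult_left_mono[OF 1]) auto
    also have "\<dots> = exp (2 * \<delta>) / \<delta> * (\<nu> v * (1 + (norm v)\<^sup>2) * exp ((\<theta> + (0, 2 * \<delta>)) \<bullet> vsq v))"
      unfolding y_def by (simp add: inner_vsq algebra_simps flip: exp_add)
    finally show "norm (B v) \<le> \<dots>" .
  qed
  have bound: "\<bar>Z (\<theta> + h) - Z \<theta> - h \<bullet> D \<theta>\<bar> \<le> (norm h)\<^sup>2 * integral\<^sup>L lebesgue B"
    if h: "norm h \<le> \<delta>" for h
  proof -
    have "\<bar>snd h\<bar> \<le> \<delta>" using h norm_snd_le[of "snd h" "fst h"] by simp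
    then have \<theta>h: "snd (\<theta> + h) < 0" using \<delta> by (simp add: \<delta>_def)
    note int = integrable_Z[OF \<theta>h] integrable_Z[OF \<theta>] integrable_inner_D[OF \<theta>, of h]
    define T where "T = (\<lambda>v. \<nu> v * exp ((\<theta> + h) \<bullet> vsq v) - \<nu> v * exp (\<theta> \<bullet> vsq v)
        - \<nu> v * exp (\<theta> \<bullet> vsq v) * (h \<bullet> vsq v))"
    have T: "integrable lebesgue T" unfolding T_def
      by (intro Bochner_Integration.integrable_diff int)
    have "Z (\<theta> + h) - Z \<theta> - h \<bullet> D \<theta> = integral\<^sup>L lebesgue T"
      unfolding T_def Z_def inner_D[OF \<theta>] using int by simp
    moreover have "\<bar>integral\<^sup>L lebesgue T\<bar> \<le> (LINT v|lebesgue. (norm h)\<^sup>2 * B v)"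
    proof (rule integral_abs_bound_integral)
      show "integrable lebesgue T" "integrable lebesgue (\<lambda>v. (norm h)\<^sup>2 * B v)"
        using T B by auto
      fix v
      define x where "x = h \<bullet> vsq v"
      define y where "y = 1 + (norm v)\<^sup>2"
      have y: "y > 0" by (simp add: y_def add_pos_nonneg)
      have x: "\<bar>x\<bar> \<le> norm h * y" unfolding x_def y_def by (rule abs_inner_vsq_le)
      have "\<bar>exp x - 1 - x\<bar> \<le> x\<^sup>2 * exp \<bar>x\<bar>" by (rule abs_exp_minus_linear_le)
      also have "\<dots> \<le> (norm h * y)\<^sup>2 * exp (\<delta> * y)"
      proof (rule mult_mono)
        show "x\<^sup>2 \<le> (norm h * y)\<^sup>2" using x by (metis abs_ge_zero power2_abs power_mono)
        have "norm h * y \<le> \<delta> * y" using h y by simp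
        then show "exp \<bar>x\<bar> \<le> exp (\<delta> * y)" using x by simp
      qed auto
      finally have "\<nu> v * exp (\<theta> \<bullet> vsq v) * \<bar>exp x - 1 - x\<bar>
          \<le> \<nu> v * exp (\<theta> \<bullet> vsq v) * ((norm h * y)\<^sup>2 * exp (\<delta> * y))"
        using pos[of v] by (intro mult_left_mono) auto
      moreover have "T v = \<nu> v * exp (\<theta> \<bullet> vsq v) * (exp x - 1 - x)"
        unfolding T_def x_def by (simp add: inner_add_left exp_add algebra_simps)
      ultimately show "\<bar>T v\<bar> \<le> (norm h)\<^sup>2 * B v"
        using pos[of v] unfolding B_def y_def[symmetric]
        by (simp add: abs_mult power_mult_distrib mult_ac)
    qed
    ultimately show ?thesis by simp
  qed
  show ?thesis
    unfolding has_derivative_at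
  proof (intro conjI)
    show "bounded_linear (\<lambda>h. h \<bullet> D \<theta>)" by (rule bounded_linear_inner_left)
    let ?I = "integral\<^sup>L lebesgue B"
    show "(\<lambda>h. norm (Z (\<theta> + h) - Z \<theta> - h \<bullet> D \<theta>) / norm h) \<midarrow>0\<rightarrow> 0"
    proof (rule tendsto_sandwich[where f = "\<lambda>h. 0" and h = "\<lambda>h. norm h * ?I"])
      show "\<forall>\<^sub>F h in at 0. norm (Z (\<theta> + h) - Z \<theta> - h \<bullet> D \<theta>) / norm h \<le> norm h * ?I"
        unfolding eventually_at
      proof (intro exI[of _ \<delta>] conjI ballI impI)
        fix h :: "'a \<times> real" assume "h \<noteq> 0 \<and> dist h 0 < \<delta>"
        then show "norm (Z (\<theta> + h) - Z \<theta> - h \<bullet> D \<theta>) / norm h \<le> norm h * ?I"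
          using bound[of h] by (simp add: divide_le_eq power2_eq_square mult_ac)
      qed (rule \<delta>)
      show "((\<lambda>h. norm h * ?I) \<longlongrightarrow> 0) (at (0::'a \<times> real))"
        by (auto intro!: tendsto_eq_intros)
    qed auto
  qed
qed

section \<open>Growth of the partition function at infinity\<close>

text \<open>
  Since \<open>exp x \<ge> max 0 x\<close>, the integral is bounded below by a positively homogeneous function of
  \<open>\<theta>\<close>, which is positive on the compact half sphere.
\<close>

lemma Z_linear_growth:
  assumes v0: "(norm v0)\<^sup>2 < e"
  obtains \<kappa> where "\<kappa> > 0" "\<And>\<theta>. snd \<theta> < 0 \<Longrightarrow> \<kappa> * norm \<theta> * exp (\<theta> \<bullet> (v0, e)) \<le> Z \<theta>"
proof -
  define \<gamma> where "\<gamma> = (0::'a, -1::real)"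
  have \<gamma>: "snd \<gamma> < 0" by (simp add: \<gamma>_def)
  \<comment> \<open>Subtracting \<open>(v0, e)\<close> takes the factor
    \<open>exp (\<theta> \<bullet> (v0, e))\<close> out of \<open>Z\<close>.\<close>
  define q where "q = (\<lambda>\<theta> v. \<theta> \<bullet> (vsq v - (v0, e)))"
  define C where "C = 1 + norm (v0, e)"
  \<comment> \<open>The Gaussian factor \<open>exp (- (norm v)\<^sup>2)\<close> makes linear
    functions of \<open>vsq\<close> integrable for every \<theta>, including
    \<open>snd \<theta> = 0\<close>; being at most 1, it preserves lower bounds for
    \<open>Z\<close>.\<close>
  define \<mu> where "\<mu> = (\<lambda>v. \<nu> v * exp (\<gamma> \<bullet> vsq v))"
  define J where "J = (\<lambda>v. C * (\<nu> v * (1 + (norm v)\<^sup>2) * exp (\<gamma> \<bullet> vsq v)))"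
  have \<mu>: "\<mu> v > 0" for v using pos by (simp add: \<mu>_def)
  have \<mu>1: "\<mu> v \<le> \<nu> v" for v
    using pos[of v] by (simp add: \<mu>_def \<gamma>_def inner_vsq)
  have J: "integrable lebesgue J" unfolding J_def using \<gamma> integrable_iff by auto
  define g where "g = (\<lambda>\<theta>. LINT v|lebesgue. \<mu> v * max 0 (q \<theta> v))"
  have q_le: "\<mu> v * \<bar>q \<theta> v\<bar> \<le> norm \<theta> * J v" for \<theta> v
  proof -
    have "norm (vsq v - (v0, e)) \<le> norm (vsq v) + norm (v0, e)" by (rule norm_triangle_ineq4)
    also have "\<dots> \<le> (1 + (norm v)\<^sup>2) + norm (v0, e) * (1 + (norm v)\<^sup>2)"
      by (intro add_mono norm_vsq_le) (simp add: algebra_simps)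
    also have "\<dots> = C * (1 + (norm v)\<^sup>2)" by (simp add: C_def algebra_simps)
    finally have "norm (vsq v - (v0, e)) \<le> C * (1 + (norm v)\<^sup>2)" .
    then have "\<bar>q \<theta> v\<bar> \<le> norm \<theta> * (C * (1 + (norm v)\<^sup>2))"
      unfolding q_def using Cauchy_Schwarz_ineq2 by (meson mult_left_mono norm_ge_zero order_trans)
    then show ?thesis using mult_left_mono[of _ _ "\<mu> v"] \<mu>[of v]
      by (fastforce simp: J_def \<mu>_def mult_ac)
  qed
  have g_int: "integrable lebesgue (\<lambda>v. \<mu> v * max 0 (q \<theta> v))" for \<theta>
  proof (rule Bochner_Integration.integrable_bound)
    show "integrable lebesgue (\<lambda>v. norm \<theta> * J v)" using J by simp
    show "(\<lambda>v. \<mu> v * max 0 (q \<theta> v)) \<in> borel_measurable lebesgue"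
      unfolding \<mu>_def q_def inner_diff_right by measurable
    have "norm (\<mu> v * max 0 (q \<theta> v)) \<le> \<mu> v * \<bar>q \<theta> v\<bar>" for v
      using \<mu>[of v] by (simp add: abs_mult)
    then show "AE v in lebesgue. norm (\<mu> v * max 0 (q \<theta> v)) \<le> norm (norm \<theta> * J v)"
      using q_le by (intro AE_I2) (smt (verit) real_norm_def)
  qed
  \<comment> \<open>Since \<open>max 0\<close> is 1-Lipschitz and \<open>q\<close> is linear in
    \<theta>, \<open>g\<close> inherits a Lipschitz bound from \<open>q_le\<close>.\<close>
  have g_lip: "\<bar>g \<theta> - g \<eta>\<bar> \<le> integral\<^sup>L lebesgue J * norm (\<theta> - \<eta>)" for \<theta> \<eta>
  proof -
    have "g \<theta> - g \<eta> = (LINT v|lebesgue. \<mu> v * max 0 (q \<theta> v) - \<mu> v * max 0 (q \<eta> v))"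
      unfolding g_def by (simp add: g_int)
    also have "\<bar>\<dots>\<bar> \<le> (LINT v|lebesgue. norm (\<theta> - \<eta>) * J v)"
    proof (rule integral_abs_bound_integral)
      fix v
      have "\<bar>\<mu> v * max 0 (q \<theta> v) - \<mu> v * max 0 (q \<eta> v)\<bar> = \<mu> v * \<bar>max 0 (q \<theta> v) - max 0 (q \<eta> v)\<bar>"
        using \<mu>[of v] by (simp add: abs_mult flip: right_diff_distrib)
      also have "\<dots> \<le> \<mu> v * \<bar>q (\<theta> - \<eta>) v\<bar>"
        using \<mu>[of v] by (intro mult_left_mono) (auto simp: q_def inner_diff_left)
      also have "\<dots> \<le> norm (\<theta> - \<eta>) * J v" by (rule q_le)
      finally show "\<bar>\<mu> v * max 0 (q \<theta> v) - \<mu> v * max 0 (q \<eta> v)\<bar> \<le> norm (\<theta> - \<eta>) * J v" .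
    qed (intro Bochner_Integration.integrable_diff g_int integrable_mult_right J)+
    finally show ?thesis by (simp add: mult.commute)
  qed
  have g_cont: "continuous_on A g" for A
  proof -
    have J0: "integral\<^sup>L lebesgue J \<ge> 0"
      using pos by (intro integral_nonneg_AE AE_I2) (auto simp: J_def C_def less_imp_le intro!: mult_nonneg_nonneg)
    have "(integral\<^sup>L lebesgue J)-lipschitz_on A g"
      using J0 g_lip by (intro lipschitz_onI) (auto simp: dist_norm)
    then show ?thesis by (rule lipschitz_on_continuous_on)
  qed
  \<comment> \<open>The equator \<open>snd \<theta> = 0\<close> is included for compactness, so the
    minimum of \<open>g\<close> gives a constant uniform up to the boundary.\<close>
  define S where "S = sphere (0::'a \<times> real) 1 \<inter> {\<theta>. snd \<theta> \<le> 0}"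
  have g_pos: "g \<theta> > 0" if "\<theta> \<in> S" for \<theta>
    unfolding g_def
  proof (rule integral_pos)
    \<comment> \<open>On the equator a step from \<open>v0\<close> along \<open>fst \<theta>\<close>
      gives \<open>(norm (fst \<theta>))\<^sup>2\<close>; elsewhere \<open>q \<theta> v0\<close> is
      the product of the negative numbers \<open>snd \<theta>\<close> and
      \<open>(norm v0)\<^sup>2 - e\<close>.\<close>
    have "\<exists>v. q \<theta> v > 0"
    proof (cases "snd \<theta> = 0")
      case True
      then have "fst \<theta> \<noteq> 0" using that by (cases \<theta>) (auto simp: S_def zero_prod_def)
      then have "q \<theta> (v0 + fst \<theta>) > 0"
        using True by (simp add: q_def inner_prod_def)
      then show ?thesis by blast
    next
      case False
      then have "q \<theta> v0 > 0"
        using that v0 by (auto simp: q_def inner_prod_def S_def intro!: mult_neg_neg)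
      then show ?thesis by blast
    qed
    then obtain u where u: "q \<theta> u > 0" by blast
    show "\<not> (AE v in lebesgue. \<mu> v * max 0 (q \<theta> v) = 0)"
    proof (rule not_AE_lebesgue_open[of "{v. 0 < q \<theta> v}" u])
      show "open {v. 0 < q \<theta> v}" unfolding q_def
        by (intro open_Collect_less continuous_intros)
    qed (use u \<mu> in \<open>auto simp: less_imp_neq[symmetric]\<close>)
  qed (use \<mu> g_int in \<open>auto simp: less_imp_le\<close>)
  have "compact S" unfolding S_def
    by (intro compact_Int_closed closed_Collect_le continuous_intros) auto
  moreover have "\<gamma> \<in> S" by (auto simp: S_def \<gamma>_def norm_Pair)
  ultimately obtain \<theta>0 where \<theta>0: "\<theta>0 \<in> S" "\<And>\<theta>. \<theta> \<in> S \<Longrightarrow> g \<theta>0 \<le> g \<theta>"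
    using continuous_attains_inf[of S g] g_cont by blast
  show thesis
  proof (rule that[of "g \<theta>0"])
    show "g \<theta>0 > 0" using g_pos \<theta>0(1) by blast
    fix \<theta> :: "'a \<times> real" assume \<theta>: "snd \<theta> < 0"
    then have n: "norm \<theta> > 0" by auto
    define \<eta> where "\<eta> = inverse (norm \<theta>) *\<^sub>R \<theta>"
    have "\<eta> \<in> S" using n \<theta> by (auto simp: S_def \<eta>_def mult_le_0_iff)
    then have "g \<theta>0 * norm \<theta> \<le> g \<eta> * norm \<theta>" using \<theta>0(2) by (simp add: mult_right_mono)
    also have "\<dots> = (LINT v|lebesgue. (\<mu> v * max 0 (q \<eta> v)) * norm \<theta>)"
      unfolding g_def by simp
    also have "\<dots> \<le> (LINT v|lebesgue. \<nu> v * exp (\<theta> \<bullet> vsq v) * exp (- (\<theta> \<bullet> (v0, e))))"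
    proof (rule integral_mono)
      show "integrable lebesgue (\<lambda>v. (\<mu> v * max 0 (q \<eta> v)) * norm \<theta>)" using g_int by simp
      show "integrable lebesgue (\<lambda>v. \<nu> v * exp (\<theta> \<bullet> vsq v) * exp (- (\<theta> \<bullet> (v0, e))))"
        using integrable_Z[OF \<theta>] by simp
      fix v
      have "q \<eta> v * norm \<theta> = q \<theta> v" using n by (simp add: \<eta>_def q_def)
      then have "max 0 (q \<eta> v) * norm \<theta> = max 0 (q \<theta> v)"
        using n by (simp add: max_mult_distrib_right)
      also have "\<dots> \<le> exp (q \<theta> v)" using exp_ge_add_one_self[of "q \<theta> v"] by (intro max.boundedI) (simp, linarith)
      finally have "\<mu> v * (max 0 (q \<eta> v) * norm \<theta>) \<le> \<nu> v * exp (q \<theta> v)"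
        using \<mu>1[of v] \<mu>[of v] by (intro mult_mono) (auto simp: less_imp_le[OF pos])
      then show "(\<mu> v * max 0 (q \<eta> v)) * norm \<theta> \<le> \<nu> v * exp (\<theta> \<bullet> vsq v) * exp (- (\<theta> \<bullet> (v0, e)))"
        by (simp add: q_def inner_diff_right mult_ac exp_diff exp_minus divide_inverse)
    qed
    also have "\<dots> = Z \<theta> * exp (- (\<theta> \<bullet> (v0, e)))" unfolding Z_def by simp
    finally show "g \<theta>0 * norm \<theta> * exp (\<theta> \<bullet> (v0, e)) \<le> Z \<theta>"
      by (simp add: exp_minus field_simps)
  qed
qed

section \<open>Mean energy near the bounding hyperplane\<close>

text \<open>A Markov inequality: if the mean of \<open>(norm v)\<^sup>2\<close> is at most
  \<open>C\<close>, the region \<open>(norm v)\<^sup>2 \<ge> 2 * C\<close> carries at most half of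
  \<open>Z \<theta>\<close>. On the rest the exponent is bounded in terms of \<open>R\<close> and
  \<open>C\<close>.\<close>

lemma Z_bounded_of_ratio:
  assumes C: "C > 0"
  obtains K where "\<And>\<theta>. \<lbrakk>snd \<theta> < 0; norm \<theta> \<le> R; snd (D \<theta>) \<le> C * Z \<theta>\<rbrakk> \<Longrightarrow> Z \<theta> \<le> K"
proof -
  define \<gamma> where "\<gamma> = (0::'a, -1::real)"
  have \<gamma>: "snd \<gamma> < 0" by (simp add: \<gamma>_def)
  \<comment> \<open>Where \<open>(norm v)\<^sup>2 < 2 * C\<close>, the exponent is at most
    \<open>R * (1 + 2 * C)\<close>; the further \<open>2 * C\<close> offsets the Gaussian exponent
    of \<gamma>.\<close>
  define A where "A = exp (2 * C + R * (1 + 2 * C))"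
  show thesis
  proof (rule that[of "2 * A * Z \<gamma>"])
    fix \<theta> :: "'a \<times> real"
    assume \<theta>: "snd \<theta> < 0" "norm \<theta> \<le> R" "snd (D \<theta>) \<le> C * Z \<theta>"
    have "Z \<theta> \<le> (LINT v|lebesgue. \<nu> v * exp (\<theta> \<bullet> vsq v) * (norm v)\<^sup>2 / (2 * C)
        + A * (\<nu> v * exp (\<gamma> \<bullet> vsq v)))"
      unfolding Z_def
    proof (rule integral_mono)
      fix v
      show "\<nu> v * exp (\<theta> \<bullet> vsq v) \<le> \<nu> v * exp (\<theta> \<bullet> vsq v) * (norm v)\<^sup>2 / (2 * C)
          + A * (\<nu> v * exp (\<gamma> \<bullet> vsq v))"
      proof (cases "(norm v)\<^sup>2 \<ge> 2 * C")
        case True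
        then have "\<nu> v * exp (\<theta> \<bullet> vsq v) * 1 \<le> \<nu> v * exp (\<theta> \<bullet> vsq v) * ((norm v)\<^sup>2 / (2 * C))"
          using pos[of v] C by (intro mult_left_mono) auto
        moreover have "0 \<le> A * (\<nu> v * exp (\<gamma> \<bullet> vsq v))" using pos[of v] by (simp add: A_def)
        ultimately show ?thesis by simp
      next
        case False
        have "\<theta> \<bullet> vsq v \<le> norm \<theta> * (1 + (norm v)\<^sup>2)" using abs_inner_vsq_le[of \<theta> v] by linarith
        also have "\<dots> \<le> R * (1 + 2 * C)" using False \<theta>(2)
          by (intro mult_mono) (use norm_ge_zero[of \<theta>] zero_le_power2[of "norm v"] in linarith)+
        finally have "\<theta> \<bullet> vsq v \<le> (2 * C + R * (1 + 2 * C)) + \<gamma> \<bullet> vsq v"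
          using False by (simp add: \<gamma>_def inner_vsq)
        then have "exp (\<theta> \<bullet> vsq v) \<le> A * exp (\<gamma> \<bullet> vsq v)"
          unfolding A_def exp_add[symmetric] by simp
        then have "\<nu> v * exp (\<theta> \<bullet> vsq v) \<le> A * (\<nu> v * exp (\<gamma> \<bullet> vsq v))"
          using pos[of v] by (simp add: mult.left_commute)
        moreover have "0 \<le> \<nu> v * exp (\<theta> \<bullet> vsq v) * (norm v)\<^sup>2 / (2 * C)"
          using pos[of v] C by simp
        ultimately show ?thesis by linarith
      qed
    qed (use integrable_Z integrable_snd_D \<theta> \<gamma> in auto)
    also have "\<dots> = snd (D \<theta>) / (2 * C) + A * Z \<gamma>"
      unfolding snd_D[OF \<theta>(1)] Z_def using integrable_Z integrable_snd_D \<theta> \<gamma> by simp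
    also have "\<dots> \<le> Z \<theta> / 2 + A * Z \<gamma>"
      using \<theta>(3) C by (simp add: field_simps)
    finally show "Z \<theta> \<le> 2 * A * Z \<gamma>" by simp
  qed
qed

text \<open>A bounded ratio would bound \<open>Z\<close> and \<open>snd D\<close> along
  \<open>X\<close>, hence their sum, the integral with weight \<open>1 + (norm v)\<^sup>2\<close>.
  Fatou carries this bound to \<open>L\<close>, where \<open>integrable_iff\<close> denies
  integrability.\<close>

lemma boundary_unbounded_ratio:
  assumes X: "X \<longlonglongrightarrow> L" and neg: "\<And>n. snd (X n) < 0" and L: "snd L = 0"
  shows "\<exists>n. snd (D (X n)) > C * Z (X n)"
proof (rule ccontr)
  assume "\<not> ?thesis"
  then have le: "snd (D (X n)) \<le> C * Z (X n)" for n by (auto simp: not_less)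
  \<comment> \<open>The Markov argument divides by its constant, so \<open>C\<close> is replaced by
    a positive one.\<close>
  define C' where "C' = max C 1"
  have C': "C' > 0" "snd (D (X n)) \<le> C' * Z (X n)" for n
  proof -
    have "C * Z (X n) \<le> C' * Z (X n)"
      using Z_pos[OF neg[of n]] by (intro mult_right_mono) (auto simp: C'_def)
    then show "snd (D (X n)) \<le> C' * Z (X n)" using le[of n] by linarith
  qed (simp add: C'_def)
  have "bounded (range X)" using X convergent_imp_bounded by blast
  then obtain R where "\<And>n. norm (X n) \<le> R" by (auto simp: bounded_iff)
  then obtain K where K: "\<And>n. Z (X n) \<le> K"
    using Z_bounded_of_ratio[OF C'(1)] neg C'(2) by metis
  define f where "f = (\<lambda>\<theta> v. \<nu> v * (1 + (norm v)\<^sup>2) * exp (\<theta> \<bullet> vsq v))"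
  have f0: "f \<theta> v \<ge> 0" for \<theta> v using pos[of v] by (simp add: f_def)
  have fm: "f \<theta> \<in> borel_measurable lebesgue" for \<theta> unfolding f_def by measurable
  have "(\<integral>\<^sup>+v. ennreal (f (X n) v) \<partial>lebesgue) \<le> ennreal (K + C' * K)" for n
  proof -
    have "integrable lebesgue (f (X n))" unfolding f_def using integrable_iff neg by simp
    then have "(\<integral>\<^sup>+v. ennreal (f (X n) v) \<partial>lebesgue) = ennreal (integral\<^sup>L lebesgue (f (X n)))"
      using f0 by (intro nn_integral_eq_integral) auto
    also have "integral\<^sup>L lebesgue (f (X n)) = Z (X n) + snd (D (X n))"
      unfolding Z_def snd_D[OF neg] f_def
      using integrable_Z[OF neg[of n]] integrable_snd_D[OF neg[of n]]
      by (subst Bochner_Integration.integral_add[symmetric]) (auto simp: algebra_simps)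
    also have "\<dots> \<le> K + C' * K"
      using K[of n] C'(2)[of n] C'(1) by (smt (verit) mult_left_mono)
    finally show ?thesis by (simp add: ennreal_leI)
  qed
  moreover have "(\<integral>\<^sup>+v. ennreal (f L v) \<partial>lebesgue)
      \<le> liminf (\<lambda>n. \<integral>\<^sup>+v. ennreal (f (X n) v) \<partial>lebesgue)"
  proof -
    have "ennreal (f L v) = liminf (\<lambda>n. ennreal (f (X n) v))" for v
    proof (rule lim_imp_Liminf[symmetric])
      show "(\<lambda>n. ennreal (f (X n) v)) \<longlonglongrightarrow> ennreal (f L v)"
        unfolding f_def by (intro tendsto_ennrealI tendsto_intros X)
    qed auto
    then show ?thesis using nn_integral_liminf[of "\<lambda>n v. ennreal (f (X n) v)" lebesgue] fm by simp
  qed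
  ultimately have "(\<integral>\<^sup>+v. ennreal (f L v) \<partial>lebesgue) \<le> ennreal (K + C' * K)"
    by (elim order_trans, intro Liminf_le) auto
  then have "(\<integral>\<^sup>+v. ennreal (f L v) \<partial>lebesgue) < \<infinity>"
    using ennreal_less_top le_less_trans by (metis infinity_ennreal_def)
  then have "integrable lebesgue (f L)"
    using fm f0 by (intro integrableI_nonneg) auto
  then show False using integrable_iff[of L] L by (simp add: f_def)
qed

end

section \<open>Mass and flux of a given density\<close>

context collision_frequency
begin

context
  fixes f :: "'a \<Rightarrow> real"
  assumes f_nonneg: "\<And>v. f v \<ge> 0"
    and f_integrable: "integrable lebesgue (\<lambda>v. \<nu> v * (1 + (norm v)\<^sup>2) * f v)"
    and f_nonzero: "\<not> (AE v in lebesgue. f v = 0)"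
begin

text \<open>Measurability enters through the integrable weighted product; dividing by the
  nonvanishing weight transfers it to \<open>\<nu> f\<close>.\<close>

lemma measurable_density: "(\<lambda>v. \<nu> v * f v) \<in> borel_measurable lebesgue"
proof -
  have "(\<lambda>v. (\<nu> v * (1 + (norm v)\<^sup>2) * f v) / (1 + (norm v)\<^sup>2)) \<in> borel_measurable lebesgue"
    using borel_measurable_integrable[OF f_integrable] by measurable
  moreover have "1 + (norm v)\<^sup>2 \<noteq> 0" for v :: 'a by (metis power_one sum_power2_eq_zero_iff zero_neq_one)
  ultimately show ?thesis by simp
qed

lemma integrable_density: "integrable lebesgue (\<lambda>v. \<nu> v * f v)"
proof (rule Bochner_Integration.integrable_bound[OF f_integrable measurable_density])
  have "\<nu> v * f v * 1 \<le> \<nu> v * f v * (1 + (norm v)\<^sup>2)" for v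
    using pos[of v] f_nonneg[of v] by (intro mult_left_mono) auto
  then show "AE v in lebesgue. norm (\<nu> v * f v) \<le> norm (\<nu> v * (1 + (norm v)\<^sup>2) * f v)"
    using pos f_nonneg by (intro AE_I2) (simp add: abs_mult less_imp_le mult_ac)
qed

lemma integrable_density_vsq: "integrable lebesgue (\<lambda>v. (\<nu> v * f v) *\<^sub>R vsq v)"
proof (rule Bochner_Integration.integrable_bound[OF f_integrable])
  show "(\<lambda>v. (\<nu> v * f v) *\<^sub>R vsq v) \<in> borel_measurable lebesgue"
    using measurable_density by measurable
  have "\<nu> v * f v * norm (vsq v) \<le> \<nu> v * f v * (1 + (norm v)\<^sup>2)" for v
    using pos[of v] f_nonneg[of v] by (intro mult_left_mono norm_vsq_le) auto
  then show "AE v in lebesgue. norm ((\<nu> v * f v) *\<^sub>R vsq v) \<le> norm (\<nu> v * (1 + (norm v)\<^sup>2) * f v)"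
    using pos f_nonneg by (intro AE_I2) (simp add: abs_mult less_imp_le mult_ac)
qed

definition mass :: real where
  "mass = (LINT v|lebesgue. \<nu> v * f v)"

definition flux :: "'a \<times> real" where
  "flux = (LINT v|lebesgue. (\<nu> v * f v) *\<^sub>R vsq v)"

lemma density_nonzero: "\<not> (AE v in lebesgue. \<nu> v * f v = 0)"
  using f_nonzero pos by (simp add: less_imp_neq[symmetric])

lemma mass_pos: "mass > 0"
  unfolding mass_def using pos f_nonneg
  by (intro integral_pos integrable_density density_nonzero) (simp add: less_imp_le)

text \<open>The gap is the variance of the probability density \<open>\<nu> f / mass\<close>.\<close>

lemma norm_mean_less: "(norm (fst flux /\<^sub>R mass))\<^sup>2 < snd flux / mass"
proof -
  define w where "w = fst flux /\<^sub>R mass"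
  \<comment> \<open>Chosen so that \<open>(norm (v - w))\<^sup>2 = h \<bullet> vsq v + (norm
    w)\<^sup>2\<close>, which expresses the variance through \<open>flux\<close> and
    \<open>mass\<close>.\<close>
  define h where "h = (- 2 *\<^sub>R w, 1::real)"
  have eq: "\<nu> v * f v * (norm (v - w))\<^sup>2 = h \<bullet> ((\<nu> v * f v) *\<^sub>R vsq v) + (norm w)\<^sup>2 * (\<nu> v * f v)" for v
  proof -
    have "(norm (v - w))\<^sup>2 = h \<bullet> vsq v + (norm w)\<^sup>2"
      unfolding inner_vsq h_def power2_norm_eq_inner
      by (simp add: inner_diff_left inner_diff_right inner_commute[of v w])
    then show ?thesis by (simp add: algebra_simps)
  qed
  note int = integrable_bounded_linear[OF bounded_linear_inner_right integrable_density_vsq, of h]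
    integrable_mult_right[OF integrable_density, of "(norm w)\<^sup>2"]
  have "0 < (LINT v|lebesgue. \<nu> v * f v * (norm (v - w))\<^sup>2)"
  proof (rule integral_pos)
    show "integrable lebesgue (\<lambda>v. \<nu> v * f v * (norm (v - w))\<^sup>2)"
      unfolding eq by (intro Bochner_Integration.integrable_add int)
    show "\<not> (AE v in lebesgue. \<nu> v * f v * (norm (v - w))\<^sup>2 = 0)"
    proof
      assume "AE v in lebesgue. \<nu> v * f v * (norm (v - w))\<^sup>2 = 0"
      \<comment> \<open>Zero variance would concentrate the density at \<open>w\<close>, a null
        set.\<close>
      moreover have "AE v in lebesgue. v \<noteq> w"
      proof -
        have "{w} \<in> null_sets lebesgue" by (simp flip: negligible_iff_null_sets)
        then show ?thesis using AE_not_in[of "{w}" lebesgue] by simp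
      qed
      ultimately have "AE v in lebesgue. \<nu> v * f v = 0" by eventually_elim auto
      then show False using density_nonzero by blast
    qed
  qed (use pos f_nonneg in \<open>simp add: less_imp_le\<close>)
  also have "\<dots> = h \<bullet> flux + (norm w)\<^sup>2 * mass"
    unfolding eq Bochner_Integration.integral_add[OF int]
      integral_bounded_linear[OF bounded_linear_inner_right integrable_density_vsq]
    by (simp add: flux_def mass_def)
  also have "fst flux = mass *\<^sub>R w" using mass_pos by (simp add: w_def)
  then have "h \<bullet> flux + (norm w)\<^sup>2 * mass = snd flux - mass * (norm w)\<^sup>2"
    by (simp add: h_def inner_prod_def power2_norm_eq_inner algebra_simps)
  finally show ?thesis using mass_pos unfolding w_def[symmetric] by (simp add: field_simps)
qed

text \<open>Logarithm of \<open>Z_linear_growth\<close> at the mean moment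
  \<open>flux / mass\<close>, admissible by the variance gap. The term
  \<open>\<theta> \<bullet> flux\<close> cancels in the dual functional, leaving the coercive
  \<open>mass * ln (norm \<theta>)\<close>.\<close>

lemma ln_Z_lower_bound:
  obtains k where "\<And>\<theta>. snd \<theta> < 0 \<Longrightarrow> k + mass * ln (norm \<theta>) + \<theta> \<bullet> flux \<le> mass * ln (Z \<theta>)"
proof -
  obtain \<kappa> where \<kappa>: "\<kappa> > 0" and
    le: "\<And>\<theta>. snd \<theta> < 0 \<Longrightarrow> \<kappa> * norm \<theta> * exp (\<theta> \<bullet> (fst flux /\<^sub>R mass, snd flux / mass)) \<le> Z \<theta>"
    using Z_linear_growth[OF norm_mean_less] by blast
  show thesis
  proof (rule that[of "mass * ln \<kappa>"])
    fix \<theta> :: "'a \<times> real" assume \<theta>: "snd \<theta> < 0"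
    then have n: "norm \<theta> > 0" by auto
    have "\<theta> \<bullet> (fst flux /\<^sub>R mass, snd flux / mass) = (\<theta> \<bullet> flux) / mass"
      by (simp add: inner_prod_def divide_inverse algebra_simps)
    then have "ln (\<kappa> * norm \<theta> * exp ((\<theta> \<bullet> flux) / mass)) \<le> ln (Z \<theta>)"
      using le[OF \<theta>] \<kappa> n Z_pos[OF \<theta>] by simp
    then have "ln \<kappa> + ln (norm \<theta>) + (\<theta> \<bullet> flux) / mass \<le> ln (Z \<theta>)"
      using \<kappa> n by (simp add: ln_mult)
    then have "mass * (ln \<kappa> + ln (norm \<theta>) + (\<theta> \<bullet> flux) / mass) \<le> mass * ln (Z \<theta>)"
      using mass_pos by (intro mult_left_mono) auto
    then show "mass * ln \<kappa> + mass * ln (norm \<theta>) + \<theta> \<bullet> flux \<le> mass * ln (Z \<theta>)"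
      using mass_pos by (simp add: algebra_simps)
  qed
qed

text \<open>The choice of \<open>a\<close> makes
  \<open>exp (m * a) = mass / Z (m *\<^sub>R \<theta>)\<close>, which balances the mass. The
  remaining moment defect is then the gradient of this species' summand in the dual
  functional.\<close>

lemma Maxwellian_moments:
  fixes m :: real
  assumes m: "m > 0" and \<theta>: "snd \<theta> < 0"
  defines "a \<equiv> ln (mass / Z (m *\<^sub>R \<theta>)) / m"
  defines "M \<equiv> \<lambda>v. exp (m * a + m * (fst \<theta> \<bullet> v) + m * snd \<theta> * (norm v)\<^sup>2)"
  shows "integrable lebesgue (\<lambda>v. m * \<nu> v * (M v - f v))"
    and "(LINT v|lebesgue. m * \<nu> v * (M v - f v)) = 0"
    and "integrable lebesgue (\<lambda>v. (m * \<nu> v * (M v - f v)) *\<^sub>R (v, (norm v)\<^sup>2))"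
    and "(LINT v|lebesgue. (m * \<nu> v * (M v - f v)) *\<^sub>R (v, (norm v)\<^sup>2))
      = m *\<^sub>R ((mass / Z (m *\<^sub>R \<theta>)) *\<^sub>R D (m *\<^sub>R \<theta>) - flux)"
proof -
  define \<eta> where "\<eta> = m *\<^sub>R \<theta>"
  define r where "r = mass / Z \<eta>"
  have \<eta>: "snd \<eta> < 0" using m \<theta> by (simp add: \<eta>_def mult_pos_neg)
  have Z: "Z \<eta> > 0" by (rule Z_pos[OF \<eta>])
  then have "exp (m * a) = r"
    using m mass_pos by (simp add: a_def r_def \<eta>_def)
  then have M: "M v = r * exp (\<eta> \<bullet> vsq v)" for v
    unfolding M_def by (simp add: exp_add inner_vsq \<eta>_def algebra_simps)
  have I: "m * \<nu> v * (M v - f v) = (m * r) * (\<nu> v * exp (\<eta> \<bullet> vsq v)) - m * (\<nu> v * f v)" for v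
    by (simp add: M algebra_simps)
  have J: "(m * \<nu> v * (M v - f v)) *\<^sub>R (v, (norm v)\<^sup>2)
      = (m * r) *\<^sub>R ((\<nu> v * exp (\<eta> \<bullet> vsq v)) *\<^sub>R vsq v) - m *\<^sub>R ((\<nu> v * f v) *\<^sub>R vsq v)" for v
    unfolding I vsq_def[symmetric] by (simp add: scaleR_diff_left)
  note intI = integrable_mult_right[OF integrable_Z[OF \<eta>], of "m * r"]
    integrable_mult_right[OF integrable_density, of m]
  note intJ = integrable_scaleR_right[OF integrable_D[OF \<eta>], of "m * r"]
    integrable_scaleR_right[OF integrable_density_vsq, of m]
  show "integrable lebesgue (\<lambda>v. m * \<nu> v * (M v - f v))"
    unfolding I by (intro Bochner_Integration.integrable_diff intI)
  show "integrable lebesgue (\<lambda>v. (m * \<nu> v * (M v - f v)) *\<^sub>R (v, (norm v)\<^sup>2))"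
    unfolding J by (intro Bochner_Integration.integrable_diff intJ)
  have "(LINT v|lebesgue. m * \<nu> v * (M v - f v)) = m * r * Z \<eta> - m * mass"
    unfolding I Bochner_Integration.integral_diff[OF intI] by (simp add: Z_def mass_def)
  then show "(LINT v|lebesgue. m * \<nu> v * (M v - f v)) = 0"
    using Z by (simp add: r_def)
  have "(LINT v|lebesgue. (m * \<nu> v * (M v - f v)) *\<^sub>R (v, (norm v)\<^sup>2))
      = (m * r) *\<^sub>R D \<eta> - m *\<^sub>R flux"
    unfolding J Bochner_Integration.integral_diff[OF intJ] integral_scaleR_right
    by (simp add: D_def flux_def)
  then show "(LINT v|lebesgue. (m * \<nu> v * (M v - f v)) *\<^sub>R (v, (norm v)\<^sup>2))
      = m *\<^sub>R ((mass / Z (m *\<^sub>R \<theta>)) *\<^sub>R D (m *\<^sub>R \<theta>) - flux)"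
    by (simp add: r_def \<eta>_def scaleR_diff_right)
qed

end

end

section \<open>From multipliers to exponents\<close>

lemma collision_frequency_of_domain:
  fixes \<nu> :: "vel \<Rightarrow> real"
  assumes m: "m > 0" and meas: "\<nu> \<in> borel_measurable lebesgue" and pos: "\<And>v. \<nu> v > 0"
    and dom: "{l. exp_mult m l \<in> coll_dom \<nu>} = {(l0, l1, l2). l2 < 0}"
  shows "collision_frequency \<nu>"
proof
  fix \<theta> :: "vel \<times> real"
  \<comment> \<open>Dividing by \<open>m\<close> cancels the mass in \<open>moment_vec\<close>, so
    the exponent is exactly \<open>\<theta> \<bullet> vsq v\<close>.\<close>
  define l where "l = (0::real, fst \<theta> /\<^sub>R m, snd \<theta> / m)"
  have E: "exp_mult m l = (\<lambda>v. exp (\<theta> \<bullet> vsq v))"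
    using m by (auto simp: exp_mult_def moment_vec_def l_def inner_vsq inner_prod_def)
  have "exp_mult m l \<in> coll_dom \<nu> \<longleftrightarrow> snd \<theta> / m < 0"
    using dom by (auto simp: l_def set_eq_iff)
  moreover have "\<not> (AE v in lebesgue. exp (\<theta> \<bullet> vsq v) = (0::real))"
    by (rule not_AE_lebesgue_open[of UNIV]) auto
  ultimately show "integrable lebesgue (\<lambda>v. \<nu> v * (1 + (norm v)\<^sup>2) * exp (\<theta> \<bullet> vsq v)) \<longleftrightarrow> snd \<theta> < 0"
    using m unfolding E coll_dom_def by (simp add: divide_less_0_iff)
qed (use meas pos in auto)

section \<open>The dual functional of two species\<close>

text \<open>The equation is the critical point condition for \<open>F\<close>. Near the boundary the
  first species alone forces the sign: its mean energy is unbounded, while that of the second is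
  nonnegative.\<close>

lemma common_multiplier:
  fixes m1 m2 :: real
  assumes cf: "collision_frequency \<nu>1" "collision_frequency \<nu>2"
    and m: "m1 > 0" "m2 > 0"
    and f1: "\<And>v. f1 v \<ge> 0" "integrable lebesgue (\<lambda>v. \<nu>1 v * (1 + (norm v)\<^sup>2) * f1 v)"
      "\<not> (AE v in lebesgue. f1 v = 0)"
    and f2: "\<And>v. f2 v \<ge> 0" "integrable lebesgue (\<lambda>v. \<nu>2 v * (1 + (norm v)\<^sup>2) * f2 v)"
      "\<not> (AE v in lebesgue. f2 v = 0)"
  defines "r1 \<equiv> collision_frequency.mass \<nu>1 f1" and "r2 \<equiv> collision_frequency.mass \<nu>2 f2"
    and "U1 \<equiv> collision_frequency.flux \<nu>1 f1" and "U2 \<equiv> collision_frequency.flux \<nu>2 f2"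
    and "Z1 \<equiv> collision_frequency.Z \<nu>1" and "Z2 \<equiv> collision_frequency.Z \<nu>2"
    and "D1 \<equiv> collision_frequency.D \<nu>1" and "D2 \<equiv> collision_frequency.D \<nu>2"
  shows "\<exists>\<theta>. snd \<theta> < 0 \<and> m1 *\<^sub>R ((r1 / Z1 (m1 *\<^sub>R \<theta>)) *\<^sub>R D1 (m1 *\<^sub>R \<theta>) - U1)
      + m2 *\<^sub>R ((r2 / Z2 (m2 *\<^sub>R \<theta>)) *\<^sub>R D2 (m2 *\<^sub>R \<theta>) - U2) = 0"
    (is "\<exists>\<theta>. _ \<and> ?G \<theta> = 0")
proof -
  interpret c1: collision_frequency \<nu>1 by (rule cf)
  interpret c2: collision_frequency \<nu>2 by (rule cf)
  have r: "r1 > 0" "r2 > 0"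
    unfolding r1_def r2_def using c1.mass_pos[OF f1] c2.mass_pos[OF f2] by auto
  have neg: "snd (m1 *\<^sub>R \<theta>) < 0" "snd (m2 *\<^sub>R \<theta>) < 0" if "snd \<theta> < 0" for \<theta> :: "'a \<times> real"
    using m that by (auto simp: mult_pos_neg)
  \<comment> \<open>The chain rule for \<open>m1 *\<^sub>R \<theta>\<close> and
    \<open>m2 *\<^sub>R \<theta>\<close> produces the mass factors of the conservation law.\<close>
  define F where "F = (\<lambda>\<theta>. (r1 * ln (Z1 (m1 *\<^sub>R \<theta>)) - (m1 *\<^sub>R \<theta>) \<bullet> U1)
      + (r2 * ln (Z2 (m2 *\<^sub>R \<theta>)) - (m2 *\<^sub>R \<theta>) \<bullet> U2))"
  show ?thesis
  proof (rule halfspace_critical_point[of F])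
    fix \<theta> :: "'a \<times> real" assume \<theta>: "snd \<theta> < 0"
    note neg = neg[OF \<theta>]
    have Z: "Z1 (m1 *\<^sub>R \<theta>) > 0" "Z2 (m2 *\<^sub>R \<theta>) > 0"
      unfolding Z1_def Z2_def using neg by (auto intro: c1.Z_pos c2.Z_pos)
    have d1: "((\<lambda>x. Z1 (m1 *\<^sub>R x)) has_derivative (\<lambda>h. (m1 *\<^sub>R h) \<bullet> D1 (m1 *\<^sub>R \<theta>))) (at \<theta>)"
      unfolding Z1_def D1_def
      by (rule has_derivative_compose[where f = "\<lambda>x. m1 *\<^sub>R x" and f' = "\<lambda>h. m1 *\<^sub>R h",
            OF _ c1.has_derivative_Z[OF neg(1)]]) (auto intro!: derivative_eq_intros)
    have d2: "((\<lambda>x. Z2 (m2 *\<^sub>R x)) has_derivative (\<lambda>h. (m2 *\<^sub>R h) \<bullet> D2 (m2 *\<^sub>R \<theta>))) (at \<theta>)"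
      unfolding Z2_def D2_def
      by (rule has_derivative_compose[where f = "\<lambda>x. m2 *\<^sub>R x" and f' = "\<lambda>h. m2 *\<^sub>R h",
            OF _ c2.has_derivative_Z[OF neg(2)]]) (auto intro!: derivative_eq_intros)
    show "(F has_derivative (\<lambda>h. h \<bullet> ?G \<theta>)) (at \<theta>)"
      unfolding F_def using Z
      by (auto intro!: derivative_eq_intros d1 d2
          simp: fun_eq_iff inner_add_right inner_diff_right field_simps)
  next
    fix K
    obtain k1 where k1: "\<And>\<theta>. snd \<theta> < 0 \<Longrightarrow> k1 + r1 * ln (norm \<theta>) + \<theta> \<bullet> U1 \<le> r1 * ln (Z1 \<theta>)"
      unfolding r1_def U1_def Z1_def using c1.ln_Z_lower_bound[OF f1] by blast
    obtain k2 where k2: "\<And>\<theta>. snd \<theta> < 0 \<Longrightarrow> k2 + r2 * ln (norm \<theta>) + \<theta> \<bullet> U2 \<le> r2 * ln (Z2 \<theta>)"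
      unfolding r2_def U2_def Z2_def using c2.ln_Z_lower_bound[OF f2] by blast
    \<comment> \<open>Splitting \<open>ln (norm (m1 *\<^sub>R \<theta>))\<close> and its analogue
      for \<open>m2\<close> yields
      \<open>c + (r1 + r2) * ln (norm \<theta>) \<le> F \<theta>\<close>.\<close>
    define c where "c = k1 + r1 * ln m1 + k2 + r2 * ln m2"
    have "norm \<theta> \<le> exp ((K - c) / (r1 + r2))" if \<theta>: "snd \<theta> < 0" and le: "F \<theta> \<le> K" for \<theta> :: "'a \<times> real"
    proof -
      have n: "norm \<theta> > 0" using \<theta> by auto
      have "k1 + r1 * ln (norm (m1 *\<^sub>R \<theta>)) + (k2 + r2 * ln (norm (m2 *\<^sub>R \<theta>))) \<le> F \<theta>"
        using k1[OF neg(1)[OF \<theta>]] k2[OF neg(2)[OF \<theta>]] unfolding F_def by linarith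
      moreover have "ln (norm (m1 *\<^sub>R \<theta>)) = ln m1 + ln (norm \<theta>)" "ln (norm (m2 *\<^sub>R \<theta>)) = ln m2 + ln (norm \<theta>)"
        using m n by (auto simp: ln_mult)
      ultimately have "(r1 + r2) * ln (norm \<theta>) \<le> K - c"
        using le by (simp add: c_def algebra_simps)
      then have "ln (norm \<theta>) \<le> (K - c) / (r1 + r2)" using r by (simp add: field_simps)
      then show ?thesis using n by (metis exp_le_cancel_iff exp_ln)
    qed
    then show "\<exists>R. \<forall>\<theta>. snd \<theta> < 0 \<longrightarrow> F \<theta> \<le> K \<longrightarrow> norm \<theta> \<le> R" by blast
  next
    fix X and L :: "'a \<times> real"
    assume X: "X \<longlonglongrightarrow> L" "\<And>n. snd (X n) < 0" "snd L = 0"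
    \<comment> \<open>The energy to be exceeded; a mean energy of species 1 above
      \<open>P / (m1 * r1)\<close> makes its term alone larger than \<open>P\<close>.\<close>
    define P where "P = m1 * snd U1 + m2 * snd U2"
    have "(\<lambda>n. m1 *\<^sub>R X n) \<longlonglongrightarrow> m1 *\<^sub>R L" by (intro tendsto_intros X)
    moreover have "snd (m1 *\<^sub>R L) = 0" using X(3) by simp
    ultimately obtain n where n: "snd (D1 (m1 *\<^sub>R X n)) > P / (m1 * r1) * Z1 (m1 *\<^sub>R X n)"
      using c1.boundary_unbounded_ratio[of "\<lambda>n. m1 *\<^sub>R X n", OF _ neg(1)[OF X(2)]]
      unfolding D1_def Z1_def by blast
    have Z: "Z1 (m1 *\<^sub>R X n) > 0" "Z2 (m2 *\<^sub>R X n) > 0"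
      unfolding Z1_def Z2_def using neg[OF X(2)] by (auto intro: c1.Z_pos c2.Z_pos)
    have "snd (D2 (m2 *\<^sub>R X n)) \<ge> 0"
      unfolding D2_def c2.snd_D[OF neg(2)[OF X(2)]]
      by (intro integral_nonneg_AE AE_I2) (simp add: less_imp_le[OF c2.pos])
    then have "m2 * (r2 / Z2 (m2 *\<^sub>R X n) * snd (D2 (m2 *\<^sub>R X n))) \<ge> 0" using Z m r by simp
    moreover have "P < m1 * (r1 / Z1 (m1 *\<^sub>R X n) * snd (D1 (m1 *\<^sub>R X n)))"
      using n Z m r by (simp add: field_simps)
    ultimately have "snd (?G (X n)) > 0" by (simp add: P_def algebra_simps)
    then show "\<exists>n. snd (?G (X n)) > 0" by blast
  qed
qed

section \<open>Multipliers of the two Maxwellians\<close>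

theorem corollary3p9:
  fixes m1 m2 :: real
    and \<nu>12 \<nu>21 f1 f2 :: "real ^ 3 \<Rightarrow> real"
  assumes m1: "m1 > 0" and m2: "m2 > 0"
    and meas12: "\<nu>12 \<in> borel_measurable lebesgue"
    and meas21: "\<nu>21 \<in> borel_measurable lebesgue"
    and pos12: "\<And>v. \<nu>12 v > 0"
    and pos21: "\<And>v. \<nu>21 v > 0"
    and dom12: "{l. exp_mult m1 l \<in> coll_dom \<nu>12} = {l. integrable lebesgue (exp_mult m1 l)}"
    and int12: "{l. integrable lebesgue (exp_mult m1 l)} = {(l0, l1, l2). l2 < 0}"
    and dom21: "{l. exp_mult m2 l \<in> coll_dom \<nu>21} = {l. integrable lebesgue (exp_mult m2 l)}"
    and int21: "{l. integrable lebesgue (exp_mult m2 l)} = {(l0, l1, l2). l2 < 0}"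
    and f1: "f1 \<in> coll_dom \<nu>12"
    and f2: "f2 \<in> coll_dom \<nu>21"
  shows "\<exists>(a12::real) (b12::real ^ 3) (c12::real) (a21::real) (b21::real ^ 3) (c21::real).
    b21 = b12 \<and> c21 = c12 \<and>
    (let M12 = (\<lambda>v. exp (m1 * a12 + m1 * (b12 \<bullet> v) + m1 * c12 * (norm v)\<^sup>2));
         M21 = (\<lambda>v. exp (m2 * a21 + m2 * (b21 \<bullet> v) + m2 * c21 * (norm v)\<^sup>2));
         I12 = (\<lambda>v. m1 * \<nu>12 v * (M12 v - f1 v));
         I21 = (\<lambda>v. m2 * \<nu>21 v * (M21 v - f2 v));
         J12 = (\<lambda>v. (m1 * \<nu>12 v * (M12 v - f1 v)) *\<^sub>R (v, (norm v)\<^sup>2));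
         J21 = (\<lambda>v. (m2 * \<nu>21 v * (M21 v - f2 v)) *\<^sub>R (v, (norm v)\<^sup>2))
     in integrable lebesgue I12 \<and> integral\<^sup>L lebesgue I12 = 0 \<and>
        integrable lebesgue I21 \<and> integral\<^sup>L lebesgue I21 = 0 \<and>
        integrable lebesgue J12 \<and> integrable lebesgue J21 \<and>
        integral\<^sup>L lebesgue J12 + integral\<^sup>L lebesgue J21 = 0)"
proof -
  have cf: "collision_frequency \<nu>12" "collision_frequency \<nu>21"
    using collision_frequency_of_domain[OF m1 meas12 pos12 dom12[unfolded int12]]
      collision_frequency_of_domain[OF m2 meas21 pos21 dom21[unfolded int21]] by auto
  have F1: "\<And>v. f1 v \<ge> 0" "integrable lebesgue (\<lambda>v. \<nu>12 v * (1 + (norm v)\<^sup>2) * f1 v)"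
      "\<not> (AE v in lebesgue. f1 v = 0)"
    and F2: "\<And>v. f2 v \<ge> 0" "integrable lebesgue (\<lambda>v. \<nu>21 v * (1 + (norm v)\<^sup>2) * f2 v)"
      "\<not> (AE v in lebesgue. f2 v = 0)"
    using f1 f2 by (auto simp: coll_dom_def)
  obtain \<theta> where \<theta>: "snd \<theta> < 0" and
    crit: "m1 *\<^sub>R ((collision_frequency.mass \<nu>12 f1 / collision_frequency.Z \<nu>12 (m1 *\<^sub>R \<theta>)) *\<^sub>R
          collision_frequency.D \<nu>12 (m1 *\<^sub>R \<theta>) - collision_frequency.flux \<nu>12 f1)
        + m2 *\<^sub>R ((collision_frequency.mass \<nu>21 f2 / collision_frequency.Z \<nu>21 (m2 *\<^sub>R \<theta>)) *\<^sub>R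
          collision_frequency.D \<nu>21 (m2 *\<^sub>R \<theta>) - collision_frequency.flux \<nu>21 f2) = 0"
    using common_multiplier[OF cf m1 m2 F1 F2] by blast
  note M12 = collision_frequency.Maxwellian_moments[OF cf(1) F1 m1 \<theta>]
  note M21 = collision_frequency.Maxwellian_moments[OF cf(2) F2 m2 \<theta>]
  show ?thesis
    \<comment> \<open>Unification with \<open>Maxwellian_moments\<close> supplies the witnesses: the
      components of \<theta> are shared, and each species gets its own normalising logarithm. The
      joint balance is then \<open>crit\<close>.\<close>
    unfolding Let_def
    by (rule exI conjI refl M12(1-3) M21(1-3))+ (use M12(4) M21(4) crit in presburger)
qed

end
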